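(* Every $\mathsf{QCD}$ space is locally doubling. That is: let $(X,d,m)$ be a geodesic Monge space satisfying $\mathsf{QCD}(Q,K,N)$ for some $Q\ge1$, $K\in\mathbb R$, $N\in(1,\infty)$. Then for every $x\in X$ there exist an open set $U\ni x$ and constants $C,R>0$ such that $m(B_{2r}(y))\le C\,m(B_r(y))$ for all $r\in(0,R)$ and all $y\in U$.
   Context: $B_r(y)$ denotes the open ball. A metric measure space $(X,d,m)$ is a complete separable metric space $(X,d)$ with an atomless Borel measure $m$ which is finite on bounded sets and has full topological support. It is geodesic if any two points are joined by a constant-speed geodesic. $\mathscr P_2(X)$ is the set of Borel probability measures with finite second moment, with the $L^2$-Wasserstein distance $W_2$; $\mathscr P^m_c(X)$ is the set of compactly supported Borel probability measures absolutely continuous w.r.t. $m$. Let $I=[0,1]$, let $\mathrm{Geo}(X,d)$ be the set of constant-speed geodesics $\gamma:I\to X$, i.e. $d(\gamma_s,\gamma_t)=|s-t|\,d(\gamma_0,\gamma_1)$, and let $\mathrm{ev}_t(\gamma)=\gamma_t$. $\mathrm{OptGeo}(\mu_0,\mu_1)$ is the set of Borel probability measures $\pi$ on $\mathcal C(I;X)$ concentrated on $\mathrm{Geo}(X,d)$ with $(\mathrm{ev}_i)_\sharp\pi=\mu_i$, $i=0,1$, and $W_2(\mu_0,\mu_1)^2=\int\int_I|\dot\gamma|_t^2\,dt\,d\pi(\gamma)$. Monge space: for every $\mu_0,\mu_1\in\mathscr P_2(X)$ with $\mu_0\ll m$: (a) there is a unique $\pi\in\mathrm{OptGeo}(\mu_0,\mu_1)$;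 (b) $\pi=T_\sharp\mu_0$ for some map $T:X\to\mathrm{Geo}(X,d)$; (c) $\mu_t:=(\mathrm{ev}_t)_\sharp\pi\ll m$ for all $t\in[0,1)$. Write $\rho_t=d\mu_t/dm$. Distortion coefficients: for $K\in\mathbb R$, $N\in(1,\infty)$, $t\in(0,1)$, $\theta\ge0$, put $\tau^{(t)}_{K,N}(\theta)=t^{1/N}\big(\sigma^{(t)}_{K,N-1}(\theta)\big)^{1-1/N}$, where, with $\kappa=K/(N-1)$, $\sigma^{(t)}_{K,N-1}(\theta)=\sin(t\theta\sqrt{\kappa})/\sin(\theta\sqrt{\kappa})$ if $K>0$ and $0<\theta<\pi/\sqrt\kappa$, $=+\infty$ if $K>0$ and $\theta\ge\pi/\sqrt\kappa$, $=t$ if $K=0$ or $\theta=0$, and $=\sinh(t\theta\sqrt{-\kappa})/\sinh(\theta\sqrt{-\kappa})$ if $K<0$ and $\theta>0$. A geodesic Monge space satisfies $\mathsf{QCD}(Q,K,N)$ if for every $\mu_0,\mu_1\in\mathscr P^m_c(X)$, with $\pi$ the unique element of $\mathrm{OptGeo}(\mu_0,\mu_1)$, $$\rho_t^{-1/N}(\gamma_t)\ge Q^{-1/N}\Big(\tau^{(1-t)}_{K,N}(d(\gamma_0,\gamma_1))\,\rho_0^{-1/N}(\gamma_0)+\tau^{(t)}_{K,N}(d(\gamma_0,\gamma_1))\,\rho_1^{-1/N}(\gamma_1)\Big)$$ for every $t\in(0,1)$ and $\pi$-a.e. $\gamma$. *)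

theory Defs
  imports "HOL-Probability.Probability"
begin

text \<open>
  The space $(X,d)$ is a type \<open>'a :: polish_space\<close> (complete separable metric) and $m$ a Borel
  measure on it. Borel measures are measures whose \<open>sets\<close> are those of \<^const>\<open>borel\<close>.
\<close>


section \<open>Metric measure spaces\<close>

definition msupport :: "'a::topological_space measure \<Rightarrow> 'a set" where
  "msupport \<mu> = {x. \<forall>U. open U \<longrightarrow> x \<in> U \<longrightarrow> emeasure \<mu> U > 0}"

text \<open>The complement \<open>A - B\<close> is used instead of comparing measures so that the notion is also the
  right one for sets of infinite measure.\<close>

definition is_atom :: "'a measure \<Rightarrow> 'a set \<Rightarrow> bool" where
  "is_atom \<mu> A \<longleftrightarrow> A \<in> sets \<mu> \<and> emeasure \<mu> A > 0 \<and>
     (\<forall>B\<in>sets \<mu>. B \<subseteq> A \<longrightarrow> emeasure \<mu> B = 0 \<or> emeasure \<mu> (A - B) = 0)"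

definition metric_measure_space :: "'a::polish_space measure \<Rightarrow> bool" where
  "metric_measure_space m \<longleftrightarrow>
     sets m = sets borel \<and>
     (\<nexists>A. is_atom m A) \<and>
     (\<forall>B\<in>sets borel. bounded B \<longrightarrow> emeasure m B < \<infinity>) \<and>
     msupport m = UNIV"


section \<open>Paths and geodesics\<close>

text \<open>
  $\mathcal C(I;X)$ with the uniform distance. Its points are functions on \<open>real\<close> that are
  continuous on \<open>{0..1}\<close> and \<^const>\<open>extensional\<close> there, so that different functions are different
  paths. \<open>path_borel\<close> is the Borel \<open>\<sigma>\<close>-algebra of this metric space.
\<close>

definition path_space :: "(real \<Rightarrow> 'a::metric_space) metric" where
  "path_space = cfunspace (top_of_set {0..1}) euclidean_metric"

definition path_borel :: "(real \<Rightarrow> 'a::metric_space) measure" where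
  "path_borel = sigma (mspace path_space) {U. openin (mtopology_of path_space) U}"

definition Geo :: "(real \<Rightarrow> 'a::metric_space) set" where
  "Geo = {\<gamma>\<in>mspace path_space.
     \<forall>s\<in>{0..1}. \<forall>t\<in>{0..1}. dist (\<gamma> s) (\<gamma> t) = \<bar>s - t\<bar> * dist (\<gamma> 0) (\<gamma> 1)}"

abbreviation (input) ev :: "real \<Rightarrow> (real \<Rightarrow> 'a) \<Rightarrow> 'a" where
  "ev t \<gamma> \<equiv> \<gamma> t"

definition metric_speed :: "(real \<Rightarrow> 'a::metric_space) \<Rightarrow> real \<Rightarrow> real" where
  "metric_speed \<gamma> t = Lim (at t within {0..1}) (\<lambda>s. dist (\<gamma> s) (\<gamma> t) / \<bar>s - t\<bar>)"


section \<open>Wasserstein distance and optimal geodesic plans\<close>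

text \<open>Real powers of extended nonnegative numbers, by continuity at \<open>0\<close> and \<open>\<infinity>\<close>.\<close>

definition epowr :: "ennreal \<Rightarrow> real \<Rightarrow> ennreal" where
  "epowr x a =
     (if a = 0 then 1
      else if x = 0 then (if a > 0 then 0 else \<infinity>)
      else if x = \<infinity> then (if a > 0 then \<infinity> else 0)
      else ennreal (enn2real x powr a))"

definition P2 :: "'a::metric_space measure set" where
  "P2 = {\<mu>. sets \<mu> = sets borel \<and> prob_space \<mu> \<and>
     (\<exists>x\<^sub>0. (\<integral>\<^sup>+ x. ennreal ((dist x\<^sub>0 x)\<^sup>2) \<partial>\<mu>) < \<infinity>)}"

definition Pcm :: "'a::metric_space measure \<Rightarrow> 'a measure set" where
  "Pcm m = {\<mu>. sets \<mu> = sets borel \<and> prob_space \<mu> \<and> compact (msupport \<mu>) \<and>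
     absolutely_continuous m \<mu>}"

definition couplings :: "'a::metric_space measure \<Rightarrow> 'a measure \<Rightarrow> ('a \<times> 'a) measure set" where
  "couplings \<mu> \<nu> = {\<omega>. sets \<omega> = sets borel \<and> prob_space \<omega> \<and>
     distr \<omega> borel fst = \<mu> \<and> distr \<omega> borel snd = \<nu>}"

definition W2 :: "'a::metric_space measure \<Rightarrow> 'a measure \<Rightarrow> ennreal" where
  "W2 \<mu> \<nu> = epowr (INF \<omega>\<in>couplings \<mu> \<nu>. \<integral>\<^sup>+ z. ennreal ((dist (fst z) (snd z))\<^sup>2) \<partial>\<omega>) (1/2)"

definition OptGeo ::
  "'a::metric_space measure \<Rightarrow> 'a measure \<Rightarrow> (real \<Rightarrow> 'a) measure set" where
  "OptGeo \<mu>\<^sub>0 \<mu>\<^sub>1 = {\<pi>. sets \<pi> = sets path_borel \<and> prob_space \<pi> \<and>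
     (AE \<gamma> in \<pi>. \<gamma> \<in> Geo) \<and>
     distr \<pi> borel (ev 0) = \<mu>\<^sub>0 \<and> distr \<pi> borel (ev 1) = \<mu>\<^sub>1 \<and>
     (W2 \<mu>\<^sub>0 \<mu>\<^sub>1)\<^sup>2 =
       (\<integral>\<^sup>+ \<gamma>. (\<integral>\<^sup>+ t\<in>{0..1}. ennreal ((metric_speed \<gamma> t)\<^sup>2) \<partial>lborel) \<partial>\<pi>)}"


section \<open>Geodesic Monge spaces\<close>

definition geodesic_space :: "'a::metric_space itself \<Rightarrow> bool" where
  "geodesic_space _ \<longleftrightarrow> (\<forall>x y::'a. \<exists>\<gamma>\<in>Geo. \<gamma> 0 = x \<and> \<gamma> 1 = y)"

definition Monge_space :: "'a::polish_space measure \<Rightarrow> bool" where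
  "Monge_space m \<longleftrightarrow> metric_measure_space m \<and>
     (\<forall>\<mu>\<^sub>0\<in>P2. \<forall>\<mu>\<^sub>1\<in>P2. absolutely_continuous m \<mu>\<^sub>0 \<longrightarrow>
        (\<exists>!\<pi>. \<pi> \<in> OptGeo \<mu>\<^sub>0 \<mu>\<^sub>1) \<and>
        (\<forall>\<pi>\<in>OptGeo \<mu>\<^sub>0 \<mu>\<^sub>1.
           (\<exists>T\<in>borel \<rightarrow>\<^sub>M path_borel. range T \<subseteq> Geo \<and> \<pi> = distr \<mu>\<^sub>0 path_borel T) \<and>
           (\<forall>t\<in>{0..<1}. absolutely_continuous m (distr \<pi> borel (ev t)))))"


section \<open>Distortion coefficients and the quasi curvature-dimension condition\<close>

text \<open>The second parameter is the dimension parameter of the coefficient, i.e.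
  \<open>sigma_coeff K (N - 1) t \<theta>\<close> is $\sigma^{(t)}_{K,N-1}(\theta)$.\<close>

definition sigma_coeff :: "real \<Rightarrow> real \<Rightarrow> real \<Rightarrow> real \<Rightarrow> ennreal" where
  "sigma_coeff K M t \<theta> = (let \<kappa> = K / M in
     if K = 0 \<or> \<theta> = 0 then ennreal t
     else if K > 0 then
       (if \<theta> < pi / sqrt \<kappa> then ennreal (sin (t * \<theta> * sqrt \<kappa>) / sin (\<theta> * sqrt \<kappa>)) else \<infinity>)
     else ennreal (sinh (t * \<theta> * sqrt (- \<kappa>)) / sinh (\<theta> * sqrt (- \<kappa>))))"

definition tau_coeff :: "real \<Rightarrow> real \<Rightarrow> real \<Rightarrow> real \<Rightarrow> ennreal" where
  "tau_coeff K N t \<theta> =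
     ennreal (t powr (1 / N)) * epowr (sigma_coeff K (N - 1) t \<theta>) (1 - 1 / N)"

text \<open>$\rho_t$ is the Radon--Nikodym density of $(\mathrm{ev}_t)_\sharp\pi$; the condition does not
  depend on the choice of its representative because the curves \<open>\<gamma>\<close> are taken up to \<open>\<pi>\<close>-null sets.\<close>

definition QCD :: "'a::polish_space measure \<Rightarrow> real \<Rightarrow> real \<Rightarrow> real \<Rightarrow> bool" where
  "QCD m Q K N \<longleftrightarrow> geodesic_space TYPE('a) \<and> Monge_space m \<and>
     (\<forall>\<mu>\<^sub>0\<in>Pcm m. \<forall>\<mu>\<^sub>1\<in>Pcm m. \<forall>\<pi>\<in>OptGeo \<mu>\<^sub>0 \<mu>\<^sub>1.
        let \<rho> = (\<lambda>t. RN_deriv m (distr \<pi> borel (ev t))) in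
        \<forall>t\<in>{0<..<1}. AE \<gamma> in \<pi>.
          epowr (\<rho> t (\<gamma> t)) (- 1 / N) \<ge>
            ennreal (Q powr (- 1 / N)) *
              (tau_coeff K N (1 - t) (dist (\<gamma> 0) (\<gamma> 1)) * epowr (\<rho> 0 (\<gamma> 0)) (- 1 / N) +
               tau_coeff K N t (dist (\<gamma> 0) (\<gamma> 1)) * epowr (\<rho> 1 (\<gamma> 1)) (- 1 / N)))"

definition locally_doubling :: "'a::metric_space measure \<Rightarrow> bool" where
  "locally_doubling m \<longleftrightarrow>
     (\<forall>x. \<exists>U (C::real) (R::real). open U \<and> x \<in> U \<and> C > 0 \<and> R > 0 \<and>
        (\<forall>y\<in>U. \<forall>r\<in>{0<..<R}.
           emeasure m (ball y (2 * r)) \<le> ennreal C * emeasure m (ball y r)))"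

end

theory Submission
  imports Defs
begin

text \<open>
  Fix \<open>r < 1\<close> and transport the normalised restriction of \<open>m\<close> to a compact \<open>A \<subseteq> ball y (2 * r)\<close> onto
  that of a compact \<open>B \<subseteq> ball y (r / 10)\<close>. At time \<open>3/4\<close> every geodesic is inside \<open>ball y r\<close>, while
  the first summand of the \<open>QCD\<close> inequality alone bounds the density of the intermediate measure
  by a constant over \<open>m A\<close>. Integrating over \<open>ball y r\<close> gives \<open>m A \<le> C * m (ball y r)\<close>, and inner
  regularity replaces \<open>A\<close> by the ball of radius \<open>2 * r\<close>. The constant depends only on the values of
  \<open>\<tau>\<close> on a bounded interval.
\<close>

section \<open>Lower bounds for the distortion coefficients at parameter \<open>1/4\<close>\<close>

lemma cosh_real_mono:
  fixes x y :: real
  assumes "0 \<le> x" "x \<le> y"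
  shows "cosh x \<le> cosh y"
  using assms by (cases "x = y") (auto intro!: less_imp_le cosh_real_strict_mono)

text \<open>Halving the angle twice gives
  \<open>sin x = 4 * sin (x/4) * (cos (x/4) * cos (x/2))\<close>, and the same for
  \<open>sinh\<close> with \<open>cosh\<close>. The quotient is thus at least \<open>1/4\<close> for
  positive \<open>K\<close>, and for negative \<open>K\<close> it loses at most two factors
  \<open>cosh\<close>. For positive \<open>K\<close> and large \<open>\<theta>\<close> the
  coefficient is infinite, so \<open>D\<close> may be arbitrary.\<close>

lemma sigma_coeff_quarter_ge:
  assumes M: "M > 0" and \<theta>: "0 \<le> \<theta>" "\<theta> \<le> D"
  shows "ennreal (1 / (4 * (cosh (D * sqrt \<bar>K / M\<bar>))\<^sup>2)) \<le> sigma_coeff K M (1/4) \<theta>"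
proof -
  define x where "x = \<theta> * sqrt \<bar>K / M\<bar>"
  define c where "c = 1 / (4 * (cosh (D * sqrt \<bar>K / M\<bar>))\<^sup>2)"
  \<comment> \<open>This lets the constant made for negative \<open>K\<close> serve the other signs
    as well.\<close>
  have c4: "c \<le> 1 / 4"
    by (simp add: c_def field_simps cosh_real_ge_1)
  have x0: "x \<ge> 0" and xD: "x \<le> D * sqrt \<bar>K / M\<bar>"
    using \<theta> by (auto simp: x_def intro!: mult_right_mono)
  consider "K = 0 \<or> \<theta> = 0" | "K > 0" "\<theta> > 0" | "K < 0" "\<theta> > 0"
    using \<theta> by linarith
  then have "ennreal c \<le> sigma_coeff K M (1/4) \<theta>"
  proof cases
    case 1
    then show ?thesis using c4 by (auto simp: sigma_coeff_def intro!: ennreal_leI)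
  next
    case 2
    show ?thesis
    proof (cases "\<theta> < pi / sqrt (K / M)")
      case True
      have x: "x = \<theta> * sqrt (K / M)" using 2 M by (simp add: x_def)
      have pos: "x > 0" using 2 M by (simp add: x)
      have "x < pi" using True 2 M by (simp add: x pos_less_divide_eq)
      then have s: "sin x > 0" "sin (x/4) > 0" using pos by (auto intro!: sin_gt_zero)
      have "sin x = 4 * sin (x/4) * (cos (x/4) * cos (x/2))"
        using sin_double[of "x/2"] sin_double[of "x/4"] by simp
      also have "cos (x/4) * cos (x/2) \<le> 1"
        by (rule order_trans[OF abs_ge_self]) (simp add: abs_mult mult_le_one)
      then have "4 * sin (x/4) * (cos (x/4) * cos (x/2)) \<le> 4 * sin (x/4)"
        using s by simp
      finally have "1/4 \<le> sin (x/4) / sin x" using s by (simp add: field_simps)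
      then have "c \<le> sin (x/4) / sin x" using c4 by linarith
      then show ?thesis using 2 True M
        by (auto simp: sigma_coeff_def x Let_def intro!: ennreal_leI)
    next
      case False
      then show ?thesis using 2 by (simp add: sigma_coeff_def)
    qed
  next
    case 3
    have x: "x = \<theta> * sqrt (- (K / M))" using 3 M
      by (simp add: x_def divide_neg_pos abs_of_neg)
    have pos: "x > 0" using 3 M by (simp add: x divide_neg_pos)
    have "sinh x = 4 * sinh (x/4) * (cosh (x/4) * cosh (x/2))"
      using sinh_double[of "x/2"] sinh_double[of "x/4"] by simp
    \<comment> \<open>Both arguments lie between \<open>0\<close> and \<open>x\<close>, which is at
      most the argument on the right.\<close>
    also have "cosh (x/4) * cosh (x/2) \<le> (cosh (D * sqrt \<bar>K / M\<bar>))\<^sup>2"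
      unfolding power2_eq_square using x0 xD by (intro mult_mono cosh_real_mono) auto
    then have "4 * sinh (x/4) * (cosh (x/4) * cosh (x/2))
        \<le> 4 * sinh (x/4) * (cosh (D * sqrt \<bar>K / M\<bar>))\<^sup>2"
      using pos by (intro mult_left_mono) auto
    finally have "c \<le> sinh (x/4) / sinh x" using pos by (simp add: c_def field_simps)
    then show ?thesis using 3
      by (auto simp: sigma_coeff_def x Let_def intro!: ennreal_leI)
  qed
  then show ?thesis by (simp only: c_def)
qed

lemma epowr_mono:
  assumes "a > 0" "c \<ge> 0" "ennreal c \<le> x"
  shows "ennreal (c powr a) \<le> epowr x a"
proof (cases x)
  case (real r)
  then show ?thesis using assms by (auto simp: epowr_def intro!: ennreal_leI powr_mono2)
next
  case top
  then show ?thesis using assms by (simp add: epowr_def)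
qed

text \<open>Negative powers are antitone, so a lower bound for a density to the power
  \<open>- 1 / N\<close> becomes an upper bound for the density. The value
  \<open>\<infinity>\<close> is excluded because its negative power is \<open>0\<close>, below
  \<open>s\<close>.\<close>

lemma le_epowr_neg_imp_le:
  assumes p: "p < 0" and s: "s > 0" and le: "ennreal s \<le> epowr x p"
  shows "x \<le> ennreal (s powr (1 / p))"
proof (cases x)
  case (real r)
  show ?thesis
  proof (cases "r = 0")
    case False
    with real have r: "r > 0" by simp
    with real p le have "s \<le> r powr p"
      by (auto simp: epowr_def)
    then have "(r powr p) powr (1 / p) \<le> s powr (1 / p)"
      using p s by (intro powr_mono2') auto
    then show ?thesis using p r real by (auto simp: powr_powr intro!: ennreal_leI)
  qed (use real in simp)
next
  case top
  then show ?thesis using p s le by (simp add: epowr_def)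
qed

text \<open>The bound \<open>c\<close> for \<open>\<sigma>\<close> passes to \<open>\<tau>\<close>
  unchanged: \<open>c\<close> is at most \<open>1/4\<close>, so it also bounds the factor
  \<open>(1/4) powr (1 / N)\<close>, and the exponents \<open>1 / N\<close> and
  \<open>1 - 1 / N\<close> add up to one.\<close>

lemma tau_coeff_quarter_ge:
  assumes N: "N > 1"
  shows "\<exists>c>0. \<forall>\<theta>\<in>{0..D}. ennreal c \<le> tau_coeff K N (1/4) \<theta>"
proof -
  define c where "c = 1 / (4 * (cosh (D * sqrt \<bar>K / (N - 1)\<bar>))\<^sup>2)"
  have c: "0 < c" "c \<le> 1/4"
    by (auto simp: c_def field_simps cosh_real_ge_1)
  have "ennreal c \<le> tau_coeff K N (1/4) \<theta>" if \<theta>: "\<theta> \<in> {0..D}" for \<theta>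
  proof -
    have "ennreal (c powr (1 - 1 / N)) \<le> epowr (sigma_coeff K (N - 1) (1/4) \<theta>) (1 - 1 / N)"
      using N c \<theta> unfolding c_def
      by (intro epowr_mono sigma_coeff_quarter_ge) auto
    moreover have "ennreal (c powr (1 / N)) \<le> ennreal ((1/4) powr (1 / N))"
      using N c by (intro ennreal_leI powr_mono2) auto
    ultimately have "ennreal (c powr (1 / N)) * ennreal (c powr (1 - 1 / N)) \<le> tau_coeff K N (1/4) \<theta>"
      unfolding tau_coeff_def by (intro mult_mono) auto
    then show ?thesis
      using c by (simp add: ennreal_mult[symmetric] powr_add[symmetric])
  qed
  then show ?thesis using c by blast
qed

section \<open>The Borel structure of the path space\<close>

text \<open>Side condition under which \<open>sigma\<close> really yields the sigma-algebra
  generated by the open sets.\<close>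

lemma path_borel_Pow:
  "{U. openin (mtopology_of path_space) U}
    \<subseteq> Pow (mspace (path_space :: (real \<Rightarrow> 'a::metric_space) metric))"
proof
  fix U assume "U \<in> {U. openin (mtopology_of (path_space :: (real \<Rightarrow> 'a) metric)) U}"
  then have "openin (mtopology_of path_space) U" by (rule CollectD)
  then have "U \<subseteq> topspace (mtopology_of path_space)" by (rule openin_subset)
  then show "U \<in> Pow (mspace path_space)" unfolding topspace_mtopology_of by (rule PowI)
qed

lemma space_path_borel [simp]:
  "space path_borel = mspace (path_space :: (real \<Rightarrow> 'a::metric_space) metric)"
  unfolding path_borel_def by (rule space_measure_of[OF path_borel_Pow])

lemma openin_path_borel:
  "openin (mtopology_of path_space) U \<Longrightarrow> U \<in> sets path_borel"
  unfolding path_borel_def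
  by (rule in_measure_of[OF path_borel_Pow CollectI])

text \<open>Evaluation is 1-Lipschitz for the uniform distance, so preimages of open sets are
  open.\<close>

lemma measurable_ev:
  fixes t :: real
  assumes t: "t \<in> {0..1}"
  shows "(\<lambda>\<gamma>. \<gamma> t) \<in> path_borel \<rightarrow>\<^sub>M (borel :: 'a::metric_space measure)"
proof (rule borel_measurableI)
  fix S :: "'a set" assume S: "open S"
  have "openin (mtopology_of path_space) ((\<lambda>\<gamma>. \<gamma> t) -` S \<inter> mspace path_space)"
    unfolding mtopology_of_def
  proof (subst Metric_space.openin_mtopology[OF Metric_space_mspace_mdist], intro conjI allI impI)
    fix \<gamma> :: "real \<Rightarrow> 'a" assume \<gamma>: "\<gamma> \<in> (\<lambda>\<gamma>. \<gamma> t) -` S \<inter> mspace path_space"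
    then obtain e where e: "e > 0" "ball (\<gamma> t) e \<subseteq> S"
      using S open_contains_ball by (metis IntD1 vimageE)
    have "Metric_space.mball (mspace path_space) (mdist path_space) \<gamma> e
        \<subseteq> (\<lambda>\<gamma>. \<gamma> t) -` S \<inter> mspace path_space"
    proof
      fix \<eta> assume "\<eta> \<in> Metric_space.mball (mspace path_space) (mdist path_space) \<gamma> e"
      then have \<eta>: "\<eta> \<in> mspace path_space" "mdist path_space \<gamma> \<eta> < e"
        by (auto simp: Metric_space.in_mball[OF Metric_space_mspace_mdist])
      have "mdist euclidean_metric (\<gamma> t) (\<eta> t) \<le> mdist path_space \<gamma> \<eta>"
        unfolding path_space_def
        by (rule mdist_cfunspace_imp_mdist_le[OF _ _ order_refl])
          (use \<gamma> \<eta> t in \<open>auto simp: path_space_def\<close>)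
      then show "\<eta> \<in> (\<lambda>\<gamma>. \<gamma> t) -` S \<inter> mspace path_space"
        using \<eta> e by auto
    qed
    then show "\<exists>r>0. Metric_space.mball (mspace path_space) (mdist path_space) \<gamma> r
        \<subseteq> (\<lambda>\<gamma>. \<gamma> t) -` S \<inter> mspace path_space"
      using e by blast
  qed auto
  then show "(\<lambda>\<gamma>. \<gamma> t) -` S \<inter> space path_borel \<in> sets path_borel"
    by (simp add: openin_path_borel)
qed

lemma Geo_dist:
  assumes "\<gamma> \<in> Geo" "s \<in> {0..1}" "t \<in> {0..1}"
  shows "dist (\<gamma> s) (\<gamma> t) = \<bar>s - t\<bar> * dist (\<gamma> 0) (\<gamma> 1)"
  using assms unfolding Geo_def by blast

section \<open>Sigma-finiteness and normalised restrictions to compact sets\<close>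

text \<open>Balls of integer radius about one point exhaust the space with finite masses.
  Radon-Nikodym derivatives with respect to \<open>m\<close> rely on this.\<close>

lemma metric_measure_space_sigma_finite:
  fixes m :: "'a::polish_space measure"
  assumes "metric_measure_space m"
  shows "sigma_finite_measure m"
proof
  fix x0 :: 'a
  have [simp]: "sets m = sets borel" using assms by (simp add: metric_measure_space_def)
  have [simp]: "space m = UNIV" using sets_eq_imp_space_eq[of m borel] by simp
  show "\<exists>A. countable A \<and> A \<subseteq> sets m \<and> \<Union> A = space m \<and> (\<forall>a\<in>A. emeasure m a \<noteq> \<infinity>)"
  proof (intro exI[of _ "range (\<lambda>n::nat. ball x0 (real n))"] conjI)
    show "\<Union> (range (\<lambda>n::nat. ball x0 (real n))) = space m"
      by (auto simp: reals_Archimedean2)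
    show "\<forall>a\<in>range (\<lambda>n::nat. ball x0 (real n)). emeasure m a \<noteq> \<infinity>"
      using assms by (auto simp: metric_measure_space_def less_top[symmetric])
  qed auto
qed

lemma closed_msupport: "closed (msupport \<mu>)"
proof -
  have "- msupport \<mu> = \<Union>{U. open U \<and> emeasure \<mu> U = 0}"
    by (auto simp: msupport_def)
  then have "open (- msupport \<mu>)" by auto
  then show ?thesis by (simp add: closed_def)
qed

lemma msupport_uniform_measure_subset:
  assumes "sets m = sets borel" "closed A"
  shows "msupport (uniform_measure m A) \<subseteq> A"
proof
  fix x assume x: "x \<in> msupport (uniform_measure m A)"
  show "x \<in> A"
  proof (rule ccontr)
    assume "x \<notin> A"
    with x assms have "emeasure (uniform_measure m A) (- A) > 0"
      by (auto simp: msupport_def)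
    moreover have "emeasure (uniform_measure m A) (- A) = 0"
      using assms by (subst emeasure_uniform_measure) auto
    ultimately show False by simp
  qed
qed

text \<open>A compact set is bounded, hence of finite mass and with bounded second moment.
  Membership in \<open>Pcm\<close> feeds the \<open>QCD\<close> inequality, membership in
  \<open>P2\<close> the Monge property.\<close>

lemma uniform_measure_in_Pcm_P2:
  fixes m :: "'a::polish_space measure"
  assumes m: "metric_measure_space m" and A: "compact A" "emeasure m A > 0"
  shows "uniform_measure m A \<in> Pcm m" "uniform_measure m A \<in> P2"
proof -
  have [measurable_cong, simp]: "sets m = sets borel" using m by (simp add: metric_measure_space_def)
  have [measurable]: "A \<in> sets borel" using A by (simp add: borel_compact)
  have fin: "emeasure m A < \<infinity>"
    using m A by (simp add: metric_measure_space_def compact_imp_bounded)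
  have prob: "prob_space (uniform_measure m A)"
    using A fin by (intro prob_space_uniform_measure) auto
  then interpret prob_space "uniform_measure m A" .
  have "msupport (uniform_measure m A) = A \<inter> msupport (uniform_measure m A)"
    using msupport_uniform_measure_subset[of m A] A compact_imp_closed by auto
  moreover have "compact (A \<inter> msupport (uniform_measure m A))"
    using A(1) closed_msupport by (rule compact_Int_closed)
  moreover have "absolutely_continuous m (uniform_measure m A)"
    unfolding uniform_measure_def by (rule absolutely_continuousI_density) measurable
  ultimately show "uniform_measure m A \<in> Pcm m"
    using prob by (simp add: Pcm_def)
  obtain x b where b: "\<And>z. z \<in> A \<Longrightarrow> dist x z \<le> b"
    using compact_imp_bounded[OF A(1)] unfolding bounded_def by blast
  have "(\<integral>\<^sup>+ z. ennreal ((dist x z)\<^sup>2) \<partial>uniform_measure m A) \<le> (\<integral>\<^sup>+ z. ennreal (b\<^sup>2) \<partial>uniform_measure m A)"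
    by (intro nn_integral_mono_AE AE_uniform_measureI)
      (auto intro!: AE_I2 ennreal_leI power_mono b)
  also have "\<dots> < \<infinity>"
    using emeasure_space_1 by (simp del: emeasure_uniform_measure space_uniform_measure)
  finally show "uniform_measure m A \<in> P2"
    using prob by (auto simp: P2_def)
qed

section \<open>The transport estimate\<close>

text \<open>Discarding the summand of the target measure bounds the density at time \<open>t\<close>
  by \<open>Q * c powr (- N)\<close> over the mass of \<open>A\<close>. This density vanishes almost
  everywhere outside \<open>S\<close> and has integral one. The constant is the same however small
  \<open>B\<close> is, so \<open>B\<close> can be placed in a tiny ball.\<close>

lemma QCD_compact_transport_bound:
  fixes m :: "'a::polish_space measure" and Q K N t c :: real
  assumes QCD: "QCD m Q K N" and Q: "Q > 0" and N: "N > 0" and t: "t \<in> {0<..<1}" and c: "c > 0"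
    and A: "compact A" "emeasure m A > 0" and B: "compact B" "emeasure m B > 0"
    and S: "S \<in> sets borel"
    and \<tau>: "\<And>x y. x \<in> A \<Longrightarrow> y \<in> B \<Longrightarrow> ennreal c \<le> tau_coeff K N (1 - t) (dist x y)"
    and AB: "\<And>\<gamma>. \<gamma> \<in> Geo \<Longrightarrow> \<gamma> 0 \<in> A \<Longrightarrow> \<gamma> 1 \<in> B \<Longrightarrow> \<gamma> t \<in> S"
  shows "emeasure m A \<le> ennreal (Q * c powr (- N)) * emeasure m S"
proof -
  define \<mu> \<nu> where "\<mu> = uniform_measure m A" and "\<nu> = uniform_measure m B"
  have Monge: "Monge_space m" using QCD by (simp add: QCD_def)
  then have mms: "metric_measure_space m" by (simp add: Monge_space_def)
  then have m_borel [measurable_cong, simp]: "sets m = sets borel" by (simp add: metric_measure_space_def)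
  interpret sigma_finite_measure m using mms by (rule metric_measure_space_sigma_finite)
  have [measurable]: "A \<in> sets borel" "B \<in> sets borel" "S \<in> sets borel"
    using A B S by (simp_all add: borel_compact)
  have "emeasure m A < \<infinity>"
    using mms A by (simp add: metric_measure_space_def compact_imp_bounded)
  then obtain a where a: "emeasure m A = ennreal a" "a > 0"
    using A by (cases "emeasure m A") auto
  have \<mu>: "\<mu> \<in> Pcm m" "\<mu> \<in> P2" and \<nu>: "\<nu> \<in> Pcm m" "\<nu> \<in> P2"
    using uniform_measure_in_Pcm_P2[OF mms] A B by (auto simp: \<mu>_def \<nu>_def)
  then have "absolutely_continuous m \<mu>" by (simp add: Pcm_def)
  \<comment> \<open>The Monge property supplies a plan, and the absolute continuity that makes its
    marginal at time \<open>t\<close> a density times \<open>m\<close>.\<close>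
  then have ex: "\<exists>!\<pi>. \<pi> \<in> OptGeo \<mu> \<nu>"
    and acs: "\<And>\<pi> s. \<pi> \<in> OptGeo \<mu> \<nu> \<Longrightarrow> s \<in> {0..<1} \<Longrightarrow> absolutely_continuous m (distr \<pi> borel (ev s))"
    using Monge \<mu>(2) \<nu>(2) unfolding Monge_space_def by blast+
  obtain \<pi> where \<pi>: "\<pi> \<in> OptGeo \<mu> \<nu>"
    and ac: "absolutely_continuous m (distr \<pi> borel (ev t))"
    using ex1_implies_ex[OF ex] acs[of _ t] t by auto
  have sets_\<pi>: "sets \<pi> = sets path_borel" using \<pi> by (simp add: OptGeo_def)
  interpret \<pi>: prob_space \<pi> using \<pi> by (simp add: OptGeo_def)
  have Geo: "AE \<gamma> in \<pi>. \<gamma> \<in> Geo" and ev0: "distr \<pi> borel (ev 0) = \<mu>" and ev1: "distr \<pi> borel (ev 1) = \<nu>"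
    using \<pi> by (auto simp: OptGeo_def)
  have ev_meas: "(\<lambda>\<gamma>. \<gamma> s) \<in> \<pi> \<rightarrow>\<^sub>M borel" if "s \<in> {0..1}" for s
    using measurable_ev[OF that] unfolding measurable_cong_sets[OF sets_\<pi> refl] .
  have evt: "(\<lambda>\<gamma>. \<gamma> t) \<in> \<pi> \<rightarrow>\<^sub>M borel"
    using t by (intro ev_meas) auto
  have [measurable]: "RN_deriv m P \<in> borel_measurable borel" for P
    using borel_measurable_RN_deriv[of m P] by simp

  \<comment> \<open>\<open>RN_deriv\<close> is known only up to null sets of \<open>m\<close>. Its
    value is carried from \<open>m\<close> to \<open>\<mu>\<close> by absolute continuity, then to
    \<open>\<pi>\<close> by evaluation at time \<open>0\<close>.\<close>
  have "AE x in m. indicator A x / emeasure m A = RN_deriv m \<mu> x"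
  proof (rule RN_deriv_unique)
    show "(\<lambda>x. indicator A x / emeasure m A) \<in> borel_measurable m" by measurable
  qed (simp add: \<mu>_def uniform_measure_def)
  then have "AE x in \<mu>. indicator A x / emeasure m A = RN_deriv m \<mu> x"
    by (rule absolutely_continuous_AE[rotated 2])
       (use \<mu> in \<open>auto simp: Pcm_def\<close>)
  moreover have "AE x in \<mu>. x \<in> A"
    unfolding \<mu>_def by (intro AE_uniform_measureI) auto
  ultimately have "AE x in \<mu>. x \<in> A \<and> RN_deriv m \<mu> x = 1 / emeasure m A"
    by eventually_elim auto
  then have start: "AE \<gamma> in \<pi>. \<gamma> 0 \<in> A \<and> RN_deriv m \<mu> (\<gamma> 0) = 1 / emeasure m A"
    unfolding ev0[symmetric] by (rule AE_distrD[OF ev_meas, rotated]) simp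
  have "AE x in \<nu>. x \<in> B"
    unfolding \<nu>_def by (intro AE_uniform_measureI) auto
  then have stop: "AE \<gamma> in \<pi>. \<gamma> 1 \<in> B"
    unfolding ev1[symmetric] by (rule AE_distrD[OF ev_meas, rotated]) simp

  define \<rho> where "\<rho> = RN_deriv m (distr \<pi> borel (ev t))"
  define C where "C = Q * c powr (- N) / a"
  have [measurable]: "\<rho> \<in> borel_measurable borel" by (simp add: \<rho>_def)
  have "AE \<gamma> in \<pi>. epowr (\<rho> (\<gamma> t)) (- 1 / N) \<ge> ennreal (Q powr (- 1 / N)) *
              (tau_coeff K N (1 - t) (dist (\<gamma> 0) (\<gamma> 1)) * epowr (RN_deriv m \<mu> (\<gamma> 0)) (- 1 / N) +
               tau_coeff K N t (dist (\<gamma> 0) (\<gamma> 1)) * epowr (RN_deriv m \<nu> (\<gamma> 1)) (- 1 / N))"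
    using QCD[unfolded QCD_def Let_def, THEN conjunct2, THEN conjunct2, rule_format, OF \<mu>(1) \<nu>(1) \<pi> t]
    unfolding \<rho>_def ev0 ev1 .
  with start stop Geo have "AE \<gamma> in \<pi>. \<rho> (\<gamma> t) \<le> ennreal C \<and> \<gamma> t \<in> S"
  proof eventually_elim
    case (elim \<gamma>)
    have "1 / emeasure m A = ennreal (1 / a)"
      using a by (simp add: divide_ennreal flip: ennreal_1)
    then have *: "epowr (RN_deriv m \<mu> (\<gamma> 0)) (- 1 / N) = ennreal (a powr (1 / N))"
      using elim a N by (auto simp: epowr_def powr_divide powr_minus_divide)
    have "ennreal (Q powr (- 1 / N) * (c * a powr (1 / N))) =
        ennreal (Q powr (- 1 / N)) * (ennreal c * epowr (RN_deriv m \<mu> (\<gamma> 0)) (- 1 / N))"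
      using c unfolding * by (simp add: ennreal_mult)
    also have "\<dots> \<le> ennreal (Q powr (- 1 / N)) *
              (tau_coeff K N (1 - t) (dist (\<gamma> 0) (\<gamma> 1)) * epowr (RN_deriv m \<mu> (\<gamma> 0)) (- 1 / N) +
               tau_coeff K N t (dist (\<gamma> 0) (\<gamma> 1)) * epowr (RN_deriv m \<nu> (\<gamma> 1)) (- 1 / N))"
      using \<tau>[of "\<gamma> 0" "\<gamma> 1"] elim
      by (intro mult_left_mono add_increasing2 mult_right_mono) auto
    also have "\<dots> \<le> epowr (\<rho> (\<gamma> t)) (- 1 / N)" using elim by simp
    \<comment> \<open>The exponent \<open>1 / (- 1 / N)\<close> is \<open>- N\<close>; it turns
      \<open>a powr (1 / N)\<close> into \<open>1 / a\<close>.\<close>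
    finally have "\<rho> (\<gamma> t) \<le> ennreal ((Q powr (- 1 / N) * (c * a powr (1 / N))) powr (1 / (- 1 / N)))"
      using Q N c a by (intro le_epowr_neg_imp_le) auto
    also have "(Q powr (- 1 / N) * (c * a powr (1 / N))) powr (1 / (- 1 / N)) = C"
    proof -
      have "(Q powr (- 1 / N) * (c * a powr (1 / N))) powr (- N)
          = (Q powr (- 1 / N)) powr (- N) * (c powr (- N) * (a powr (1 / N)) powr (- N))"
        using Q c a by (simp add: powr_mult)
      also have "\<dots> = C"
        using Q N a unfolding powr_powr by (simp add: C_def powr_minus_divide)
      finally show ?thesis using N by simp
    qed
    finally show ?case using elim AB by auto
  qed
  moreover have "{x \<in> space borel. \<rho> x \<le> ennreal C \<and> x \<in> S} \<in> sets borel" by measurable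
  ultimately have bound: "AE x in distr \<pi> borel (ev t). \<rho> x \<le> ennreal C \<and> x \<in> S"
    by (simp only: AE_distr_iff[OF evt])
  have dens: "density m \<rho> = distr \<pi> borel (ev t)"
    unfolding \<rho>_def using ac by (intro density_RN_deriv) auto
  have "AE x in m. 0 < \<rho> x \<longrightarrow> \<rho> x \<le> ennreal C \<and> x \<in> S"
    using bound unfolding dens[symmetric] by (subst (asm) AE_density) auto
  \<comment> \<open>Points of zero density satisfy this trivially; all others lie in
    \<open>S\<close> up to a null set.\<close>
  then have *: "AE x in m. \<rho> x \<le> ennreal C * indicator S x"
    by eventually_elim (auto simp: indicator_def not_less)
  have "prob_space (density m \<rho>)"
    unfolding dens by (rule \<pi>.prob_space_distr[OF evt])
  then have "1 = emeasure (density m \<rho>) (space m)"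
    using prob_space.emeasure_space_1 by force
  also have "\<dots> = (\<integral>\<^sup>+ x. \<rho> x * indicator (space m) x \<partial>m)"
    by (rule emeasure_density) (auto simp del: m_borel)
  also have "\<dots> = (\<integral>\<^sup>+ x. \<rho> x \<partial>m)"
    by (intro nn_integral_cong) simp
  also have "\<dots> \<le> (\<integral>\<^sup>+ x. ennreal C * indicator S x \<partial>m)"
    by (rule nn_integral_mono_AE[OF *])
  also have "\<dots> = ennreal C * emeasure m S"
    by (simp add: nn_integral_cmult_indicator)
  \<comment> \<open>Multiplying by the mass \<open>a\<close> of \<open>A\<close> cancels the factor
    \<open>1 / a\<close> in \<open>C\<close>.\<close>
  finally have "ennreal a * 1 \<le> ennreal a * (ennreal C * emeasure m S)"
    by (rule mult_left_mono) simp
  also have "\<dots> = ennreal (Q * c powr (- N)) * emeasure m S"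
    using a Q by (simp add: C_def mult.assoc[symmetric] ennreal_mult[symmetric])
  finally show ?thesis using a by simp
qed

section \<open>Inner regularity on balls and the doubling estimate\<close>

text \<open>The restriction \<open>M\<close> of \<open>m\<close> to the ball is a finite measure, to
  which \<open>inner_regular\<close> applies. On subsets of the ball both measures agree.\<close>

lemma emeasure_ball_inner_regular:
  fixes m :: "'a::polish_space measure"
  assumes m: "metric_measure_space m"
  shows "emeasure m (ball y r) = (SUP A \<in> {A. A \<subseteq> ball y r \<and> compact A}. emeasure m A)"
proof -
  have [simp]: "sets m = sets borel" using m by (simp add: metric_measure_space_def)
  have [simp]: "space m = UNIV" using sets_eq_imp_space_eq[of m borel] by simp
  define M where "M = density m (indicator (ball y r))"
  have M: "emeasure M A = emeasure m (ball y r \<inter> A)" if "A \<in> sets borel" for A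
    using that unfolding M_def by (simp add: emeasure_restricted)
  have "emeasure m (ball y r) = emeasure M (ball y r)" by (simp add: M)
  also have "\<dots> = (SUP A \<in> {A. A \<subseteq> ball y r \<and> compact A}. emeasure M A)"
  proof (rule inner_regular)
    show "sets M = sets borel" by (simp add: M_def)
    have "emeasure M (space M) = emeasure m (ball y r)" by (simp add: M_def emeasure_restricted)
    also have "\<dots> < \<infinity>" using m by (simp add: metric_measure_space_def)
    finally show "emeasure M (space M) \<noteq> \<infinity>" by simp
  qed simp
  also have "\<dots> = (SUP A \<in> {A. A \<subseteq> ball y r \<and> compact A}. emeasure m A)"
    by (intro SUP_cong) (auto simp: M borel_compact Int_absorb1)
  finally show ?thesis .
qed

theorem corollary2p8:
  fixes m :: "'a::polish_space measure" and Q K N :: real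
  assumes "geodesic_space TYPE('a)" and "Monge_space m"
    and "Q \<ge> 1" and "N > 1"
    and "QCD m Q K N"
  shows "locally_doubling m"
proof -
  have mms: "metric_measure_space m" using \<open>Monge_space m\<close> by (simp add: Monge_space_def)
  \<comment> \<open>The interval up to \<open>3\<close> covers all transport distances below: they
    are less than \<open>21/10 * r\<close>, and \<open>r < 1\<close>. The parameter
    \<open>1/4\<close> is \<open>1 - 3/4\<close>.\<close>
  obtain c where c: "c > 0" "\<And>\<theta>. \<theta> \<in> {0..3} \<Longrightarrow> ennreal c \<le> tau_coeff K N (1/4) \<theta>"
    using tau_coeff_quarter_ge[OF \<open>N > 1\<close>] by blast
  have doubling: "emeasure m (ball y (2 * r)) \<le> ennreal (Q * c powr (- N)) * emeasure m (ball y r)"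
    if r: "0 < r" "r < 1" for y r
  proof -
    \<comment> \<open>Full support makes the target ball charged, and inner regularity then yields a
      compact \<open>B\<close> of positive mass in it.\<close>
    have "emeasure m (ball y (r/10)) > 0"
    proof -
      have "y \<in> msupport m" using mms by (simp add: metric_measure_space_def)
      moreover have "y \<in> ball y (r/10)" using r by simp
      ultimately show ?thesis unfolding msupport_def by blast
    qed
    then obtain B where B: "B \<subseteq> ball y (r/10)" "compact B" "emeasure m B > 0"
      unfolding emeasure_ball_inner_regular[OF mms, of y "r/10"] less_SUP_iff by blast
    have "emeasure m A \<le> ennreal (Q * c powr (- N)) * emeasure m (ball y r)"
      if A: "A \<subseteq> ball y (2 * r)" "compact A" for A
    proof (cases "emeasure m A > 0")
      case True
      have d: "dist x z < 21/10 * r" if "x \<in> A" "z \<in> B" for x z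
      proof -
        have "dist y x < 2 * r" "dist y z < r/10" using that A B by auto
        then show ?thesis using dist_triangle2[of x z y] by (simp add: dist_commute)
      qed
      show ?thesis
      proof (rule QCD_compact_transport_bound[OF \<open>QCD m Q K N\<close>, where t = "3/4" and B = B])
        fix x z assume "x \<in> A" "z \<in> B"
        then show "ennreal c \<le> tau_coeff K N (1 - 3/4) (dist x z)"
          using d[of x z] r c(2)[of "dist x z"] by simp
      next
        fix \<gamma> assume \<gamma>: "\<gamma> \<in> (Geo :: (real \<Rightarrow> 'a) set)" "\<gamma> 0 \<in> A" "\<gamma> 1 \<in> B"
        \<comment> \<open>Only a quarter of the geodesic remains, so the distance to
          \<open>y\<close> is below \<open>21/40 * r + r/10 = 5/8 * r\<close>.\<close>
        have "dist (\<gamma> (3/4)) (\<gamma> 1) = 1/4 * dist (\<gamma> 0) (\<gamma> 1)"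
          using Geo_dist[OF \<gamma>(1), of "3/4" 1] by simp
        then have "dist (\<gamma> 1) (\<gamma> (3/4)) < 21/40 * r" using d[OF \<gamma>(2,3)] by (simp add: dist_commute)
        moreover have "dist y (\<gamma> 1) < r/10" using \<gamma> B by auto
        ultimately show "\<gamma> (3/4) \<in> ball y r"
          using dist_triangle[of y "\<gamma> (3/4)" "\<gamma> 1"] r by simp
      qed (use assms c A B True in auto)
    qed simp
    then show ?thesis
      unfolding emeasure_ball_inner_regular[OF mms, of y "2 * r"] by (intro SUP_least) auto
  qed
  show ?thesis
    unfolding locally_doubling_def
  proof
    fix x :: 'a
    show "\<exists>U (C::real) (R::real). open U \<and> x \<in> U \<and> C > 0 \<and> R > 0 \<and>
        (\<forall>y\<in>U. \<forall>r\<in>{0<..<R}. emeasure m (ball y (2 * r)) \<le> ennreal C * emeasure m (ball y r))"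
      using doubling \<open>Q \<ge> 1\<close> c(1)
      \<comment> \<open>The constant depends on neither the centre nor the radius, so the whole
        space is an admissible neighbourhood.\<close>
      by (intro exI[of _ UNIV] exI[of _ "Q * c powr (- N)"] exI[of _ 1]) auto
  qed
qed

end
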